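(* Let $G$ be a finite connected regular triangle-free graph and let $f:V(G)\to V(G)$ be an automorphism of $G$. Then $\tilde A(G,G,f)=\mathrm{Aut}(G\otimes_f G)$, i.e. every automorphism of $G\otimes_f G$ respects the fundamental edge partition.
   Context: Graphs are undirected and simple. For graphs $G,H$ and a function $f:V(G)\to V(H)$, the Sierpiński product $G\otimes_f H$ is the graph with vertex set $V(G)\times V(H)$ and the following edges: the inner edges $\{(g,h),(g,h')\}$ for every $g\in V(G)$ and every $\{h,h'\}\in E(H)$; and the connecting edges $\{(g,f(g')),(g',f(g))\}$ for every $\{g,g'\}\in E(G)$. This partition of the edge set into inner and connecting edges is the fundamental edge partition. An automorphism of $G\otimes_f H$ respects the fundamental edge partition if it takes inner edges to inner edges and connecting edges to connecting edges. $\tilde A(G,H,f)$ denotes the group of all automorphisms of $G\otimes_f H$ that respect the fundamental edge partition. *)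

theory Defs
  imports "Graph_Theory.Graph_Theory" "HOL-Algebra.Bij"
begin

text \<open>
  Simple undirected graphs are loop-free symmetric digraphs without parallel arcs, as in
  \<^locale>\<open>pair_graph\<close> (which also includes finiteness). An undirected edge \<open>{u, v}\<close> is
  represented by the two arcs \<open>(u, v)\<close> and \<open>(v, u)\<close>.
\<close>

definition regular_graph :: "'a pair_pre_digraph \<Rightarrow> bool" where
  "regular_graph G \<longleftrightarrow> (\<exists>d. \<forall>v \<in> pverts G. out_degree (with_proj G) v = d)"

definition triangle_free :: "'a pair_pre_digraph \<Rightarrow> bool" where
  "triangle_free G \<longleftrightarrow>
    \<not> (\<exists>u v w. (u, v) \<in> parcs G \<and> (v, w) \<in> parcs G \<and> (w, u) \<in> parcs G)"

definition graph_automorphism :: "'a pair_pre_digraph \<Rightarrow> ('a \<Rightarrow> 'a) \<Rightarrow> bool" where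
  "graph_automorphism G \<pi> \<longleftrightarrow> bij_betw \<pi> (pverts G) (pverts G) \<and>
    (\<forall>u \<in> pverts G. \<forall>v \<in> pverts G. (u, v) \<in> parcs G \<longleftrightarrow> (\<pi> u, \<pi> v) \<in> parcs G)"

text \<open>
  Elements of \<^term>\<open>Bij S\<close> are extensional, that is \<open>undefined\<close> outside \<open>S\<close>, so every
  automorphism (as a map on the vertex set) occurs exactly once in the group.
\<close>

definition Aut :: "'a pair_pre_digraph \<Rightarrow> ('a \<Rightarrow> 'a) monoid" where
  "Aut G = BijGroup (pverts G)
    \<lparr>carrier := {\<pi> \<in> Bij (pverts G). graph_automorphism G \<pi>}\<rparr>"

definition inner_arcs ::
  "'a pair_pre_digraph \<Rightarrow> 'b pair_pre_digraph \<Rightarrow> ('a \<times> 'b) rel" where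
  "inner_arcs G H = {((g, h), (g, h')) | g h h'. g \<in> pverts G \<and> (h, h') \<in> parcs H}"

definition connecting_arcs ::
  "'a pair_pre_digraph \<Rightarrow> ('a \<Rightarrow> 'b) \<Rightarrow> ('a \<times> 'b) rel" where
  "connecting_arcs G f = {((g, f g'), (g', f g)) | g g'. (g, g') \<in> parcs G}"

definition sierpinski_product ::
  "'a pair_pre_digraph \<Rightarrow> 'b pair_pre_digraph \<Rightarrow> ('a \<Rightarrow> 'b) \<Rightarrow> ('a \<times> 'b) pair_pre_digraph" where
  "sierpinski_product G H f =
    \<lparr>pverts = pverts G \<times> pverts H, parcs = inner_arcs G H \<union> connecting_arcs G f\<rparr>"

definition respects_fundamental_partition ::
  "'a pair_pre_digraph \<Rightarrow> 'b pair_pre_digraph \<Rightarrow> ('a \<Rightarrow> 'b) \<Rightarrow> ('a \<times> 'b \<Rightarrow> 'a \<times> 'b) \<Rightarrow> bool" where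
  "respects_fundamental_partition G H f \<pi> \<longleftrightarrow>
    (\<forall>(x, y) \<in> inner_arcs G H. (\<pi> x, \<pi> y) \<in> inner_arcs G H) \<and>
    (\<forall>(x, y) \<in> connecting_arcs G f. (\<pi> x, \<pi> y) \<in> connecting_arcs G f)"

text \<open>The group $\tilde{A}(G, H, f)$.\<close>

definition A_tilde ::
  "'a pair_pre_digraph \<Rightarrow> 'b pair_pre_digraph \<Rightarrow> ('a \<Rightarrow> 'b) \<Rightarrow> ('a \<times> 'b \<Rightarrow> 'a \<times> 'b) monoid" where
  "A_tilde G H f = (Aut (sierpinski_product G H f))
    \<lparr>carrier := {\<pi> \<in> carrier (Aut (sierpinski_product G H f)).
                    respects_fundamental_partition G H f \<pi>}\<rparr>"

lemma pair_graph_sierpinski_product: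
  assumes "pair_graph G" "pair_graph H" "f ` pverts G \<subseteq> pverts H"
  shows "pair_graph (sierpinski_product G H f)"
proof -
  interpret G: pair_graph G by fact
  interpret H: pair_graph H by fact
  let ?V = "pverts G \<times> pverts H"
  let ?A = "inner_arcs G H \<union> connecting_arcs G f"
  have wf: "?A \<subseteq> ?V \<times> ?V"
    using assms(3) by (auto simp: inner_arcs_def connecting_arcs_def
        dest: G.in_arcsD1 G.in_arcsD2 H.in_arcsD1 H.in_arcsD2)
  have fin: "finite ?V" by simp
  have "finite ?A" using wf fin by (meson finite_SigmaI finite_subset)
  moreover have "sym ?A"
    by (auto simp: sym_def inner_arcs_def connecting_arcs_def
        intro: G.arcs_symmetric H.arcs_symmetric)
  moreover have "\<forall>e \<in> ?A. fst e \<noteq> snd e"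
    by (auto simp: inner_arcs_def connecting_arcs_def dest: G.no_loops' H.no_loops')
  ultimately show ?thesis
    using wf fin unfolding sierpinski_product_def
    by unfold_locales (auto simp: symmetric_def)
qed

lemma inner_connecting_disjoint:
  assumes "pair_graph G"
  shows "inner_arcs G H \<inter> connecting_arcs G f = {}"
proof -
  interpret pair_graph G by fact
  show ?thesis by (auto simp: inner_arcs_def connecting_arcs_def dest: no_loops')
qed

end

theory Submission
  imports Defs
begin

text \<open>
  Every vertex of \<open>G \<otimes>\<^sub>f G\<close> lies on at most one connecting edge, so for a \<open>d\<close>-regular \<open>G\<close> it has
  degree \<open>d + 1\<close> if it lies on a connecting edge and degree \<open>d\<close> otherwise. If both ends \<open>(g, f a)\<close>
  and \<open>(g, f b)\<close> of an inner edge lay on connecting edges, then \<open>g, a, b\<close> would form a triangle.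
  Hence the connecting edges are exactly the edges with both ends of degree \<open>d + 1\<close>, a property
  invariant under automorphisms.
\<close>

lemma out_degree_with_proj: "out_degree (with_proj G) v = card (parcs G `` {v})"
proof -
  have "bij_betw snd (out_arcs (with_proj G) v) (parcs G `` {v})"
    by (force simp: bij_betw_def inj_on_def out_arcs_def)
  then show ?thesis
    unfolding out_degree_def by (rule bij_betw_same_card)
qed

text \<open>The map \<open>\<pi>\<close> carries the neighbours of \<open>x\<close> bijectively onto
  those of \<open>\<pi> x\<close>. It is onto because a neighbour of \<open>\<pi> x\<close> is a
  vertex, hence an image under \<open>\<pi>\<close>, and \<open>\<pi>\<close> reflects
  adjacency.\<close>

lemma graph_automorphism_card_nbrs:
  assumes "parcs G \<subseteq> pverts G \<times> pverts G" "graph_automorphism G \<pi>" "x \<in> pverts G"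
  shows "card (parcs G `` {\<pi> x}) = card (parcs G `` {x})"
proof -
  have bij: "bij_betw \<pi> (pverts G) (pverts G)"
    and arc: "\<And>u v. u \<in> pverts G \<Longrightarrow> v \<in> pverts G \<Longrightarrow> (u, v) \<in> parcs G \<longleftrightarrow> (\<pi> u, \<pi> v) \<in> parcs G"
    using assms(2) by (auto simp: graph_automorphism_def)
  have "parcs G `` {\<pi> x} = \<pi> ` (parcs G `` {x})"
  proof (intro equalityI subsetI)
    fix y assume y: "y \<in> parcs G `` {\<pi> x}"
    then have "y \<in> \<pi> ` pverts G"
      using assms(1) bij by (auto simp: bij_betw_def)
    then show "y \<in> \<pi> ` (parcs G `` {x})"
      using y arc assms(3) by auto
  next
    fix y assume "y \<in> \<pi> ` (parcs G `` {x})"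
    then show "y \<in> parcs G `` {\<pi> x}"
      using arc assms(1,3) by auto
  qed
  moreover have "inj_on \<pi> (parcs G `` {x})"
    using bij assms(1) by (auto simp: bij_betw_def intro: inj_on_subset)
  ultimately show ?thesis
    by (simp add: card_image)
qed

text \<open>The inner neighbours of \<open>(g, h)\<close> are a copy of the neighbours of
  \<open>h\<close>. Injectivity of \<open>f\<close> allows at most one connecting neighbour.\<close>

lemma card_nbrs_sierpinski_product:
  assumes "pair_graph G" "pair_graph H" "inj_on f (pverts G)" "g \<in> pverts G"
  shows "card (parcs (sierpinski_product G H f) `` {(g, h)}) =
    card (parcs H `` {h}) + (if (g, h) \<in> Domain (connecting_arcs G f) then 1 else 0)"
proof -
  interpret G: pair_graph G by fact
  interpret H: pair_graph H by fact
  let ?I = "inner_arcs G H `` {(g, h)}" and ?C = "connecting_arcs G f `` {(g, h)}"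
  have I: "?I = Pair g ` (parcs H `` {h})"
    using assms(4) by (auto simp: inner_arcs_def)
  have "parcs H `` {h} \<subseteq> pverts H"
    by (auto dest: H.in_arcsD2)
  then have "finite ?I"
    unfolding I by (meson H.finite_verts finite_imageI finite_subset)
  have "card ?I = card (parcs H `` {h})"
    unfolding I by (simp add: card_image inj_on_def)
  \<comment> \<open>A connecting arc out of \<open>(g, h)\<close> ends in \<open>(g', f g)\<close>
    with \<open>h = f g'\<close>, so \<open>h\<close> determines \<open>g'\<close> and with it the
    head.\<close>
  have unique: "y = z" if "y \<in> ?C" "z \<in> ?C" for y z
    using that assms(3)
    by (auto simp: connecting_arcs_def dest: inj_onD G.in_arcsD2)
  have C: "finite ?C \<and> card ?C = (if (g, h) \<in> Domain (connecting_arcs G f) then 1 else 0)"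
  proof (cases "?C = {}")
    case True
    then show ?thesis by auto
  next
    case False
    then obtain y where "y \<in> ?C" by blast
    then have "?C = {y}" "(g, h) \<in> Domain (connecting_arcs G f)"
      using unique by blast+
    then show ?thesis by simp
  qed
  have "?I \<inter> ?C = {}"
    using inner_connecting_disjoint[OF assms(1), of H f] by blast
  then have "card (?I \<union> ?C) = card ?I + card ?C"
    using \<open>finite ?I\<close> C by (intro card_Un_disjoint) auto
  then show ?thesis
    using C \<open>card ?I = _\<close> by (simp add: sierpinski_product_def Un_Image)
qed

text \<open>Swapping \<open>g\<close> and \<open>g'\<close> reverses a connecting arc, so every head
  is also a tail.\<close>

lemma connecting_arcs_subset_Domain:
  assumes "pair_graph G"
  shows "connecting_arcs G f \<subseteq>
    Domain (connecting_arcs G f) \<times> Domain (connecting_arcs G f)"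
proof -
  interpret pair_graph G by fact
  show ?thesis
    by (auto simp: connecting_arcs_def intro: arcs_symmetric)
qed

lemma inner_arcs_disjoint_Domain:
  assumes "pair_graph G" "triangle_free G" "graph_automorphism G f"
  shows "inner_arcs G G \<inter>
    Domain (connecting_arcs G f) \<times> Domain (connecting_arcs G f) = {}"
proof -
  interpret pair_graph G by fact
  have False if "(g, a) \<in> parcs G" "(g, b) \<in> parcs G" "(f a, f b) \<in> parcs G" for g a b
  proof -
    \<comment> \<open>An automorphism also reflects adjacency, so the arc between \<open>f a\<close>
      and \<open>f b\<close> pulls back and closes the triangle on \<open>g\<close>,
      \<open>a\<close>, \<open>b\<close>.\<close>
    have "(a, b) \<in> parcs G"
      using that assms(3) by (auto simp: graph_automorphism_def dest: in_arcsD2)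
    then show False
      using that assms(2) arcs_symmetric unfolding triangle_free_def by blast
  qed
  then show ?thesis
    by (auto simp: inner_arcs_def connecting_arcs_def)
qed

theorem theorem3p22:
  fixes G :: "'a pair_pre_digraph" and f :: "'a \<Rightarrow> 'a"
  assumes "pair_graph G"
    and "connected (with_proj G)"
    and "regular_graph G"
    and "triangle_free G"
    and "graph_automorphism G f"
  shows "A_tilde G G f = Aut (sierpinski_product G G f)"
proof -
  let ?S = "sierpinski_product G G f" and ?I = "inner_arcs G G" and ?C = "connecting_arcs G f"
  have inj: "inj_on f (pverts G)" and sub: "f ` pverts G \<subseteq> pverts G"
    using assms(5) by (auto simp: graph_automorphism_def bij_betw_def)
  interpret S: pair_graph ?S
    using assms(1) assms(1) sub by (rule pair_graph_sierpinski_product)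
  have wf: "parcs ?S \<subseteq> pverts ?S \<times> pverts ?S"
    by (auto dest: S.in_arcsD1 S.in_arcsD2)
  have arcs: "parcs ?S = ?I \<union> ?C" and verts: "pverts ?S = pverts G \<times> pverts G"
    by (auto simp: sierpinski_product_def)
  obtain d where d: "\<And>v. v \<in> pverts G \<Longrightarrow> card (parcs G `` {v}) = d"
    using assms(3) by (auto simp: regular_graph_def out_degree_with_proj)
  \<comment> \<open>By regularity the inner edges contribute \<open>d\<close> at every vertex, so
    only a connecting edge can raise the degree to \<open>Suc d\<close>.\<close>
  have deg: "x \<in> Domain ?C \<longleftrightarrow> card (parcs ?S `` {x}) = Suc d" if "x \<in> pverts ?S" for x
    using that card_nbrs_sierpinski_product[OF assms(1,1) inj] d
    by (auto simp: verts split: if_splits)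
  have conn: "(x, y) \<in> ?C \<longleftrightarrow> x \<in> Domain ?C \<and> y \<in> Domain ?C" if "(x, y) \<in> parcs ?S" for x y
    using that connecting_arcs_subset_Domain[OF assms(1), of f]
      inner_arcs_disjoint_Domain[OF assms(1,4,5)] arcs by blast
  have "respects_fundamental_partition G G f \<pi>" if \<pi>: "graph_automorphism ?S \<pi>" for \<pi>
  proof -
    have vert: "\<pi> x \<in> pverts ?S" if "x \<in> pverts ?S" for x
      using \<pi> that by (auto simp: graph_automorphism_def dest: bij_betwE)
    have dom: "\<pi> x \<in> Domain ?C \<longleftrightarrow> x \<in> Domain ?C" if "x \<in> pverts ?S" for x
      using deg that vert graph_automorphism_card_nbrs[OF wf \<pi>] by simp
    have arc: "(\<pi> x, \<pi> y) \<in> parcs ?S" if "(x, y) \<in> parcs ?S" for x y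
      using \<pi> that wf by (auto simp: graph_automorphism_def)
    \<comment> \<open>The equivalence matters: its converse direction keeps the image of an inner
      arc out of \<open>?C\<close>, and that image is an arc of \<open>?S\<close>, hence
      inner.\<close>
    have "(\<pi> x, \<pi> y) \<in> ?C \<longleftrightarrow> (x, y) \<in> ?C" if "(x, y) \<in> parcs ?S" for x y
      using conn[OF that] conn[OF arc[OF that]] dom that wf by blast
    then show ?thesis
      using arc arcs inner_connecting_disjoint[OF assms(1), of G f]
      unfolding respects_fundamental_partition_def by blast
  qed
  \<comment> \<open>The two groups differ at most in their carriers, so equal carriers
    suffice.\<close>
  then have "{\<pi> \<in> carrier (Aut ?S). respects_fundamental_partition G G f \<pi>} = carrier (Aut ?S)"
    by (auto simp: Aut_def)
  then show ?thesis
    by (simp add: A_tilde_def)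
qed

end
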